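(* Let $x^0$ be the unique critical point of the system $F_j(x)=0$, $j=1,\dots,l$, in the interior of the closed ball $B=B(x^0)\subset\Omega$ centered at $x^0$. Then $T=M$ in $B(x^0)$, where, working in $B(x^0)$, $T$ is the generalized solution of the system in $x^0$ and $M$ is the connected component containing $x^0$ of the solution set of the system.
   Context: Setting: $1\le l\le d-1$ are integers, $\Omega\subset\mathbb{R}^d$ is a bounded domain, $x^0\in\Omega$, $F_1,\dots,F_l\in C^1(\Omega)$ are real valued with $F_j(x^0)=0$, $j=1,\dots,l$. $J(x)$ denotes the Jacobian matrix of $(F_1,\dots,F_l)$ at $x$. A critical point of the system is a point $x$ with $F_j(x)=0$, $j=1,\dots,l$, and $\operatorname{rank}J(x)<l$. It is a standing assumption that there is at least one sequence $\{x^n\}$ with $$x^n\to x^0,\qquad\operatorname{rank}J(x^n)=l\ \ \forall n.\qquad( * )$$ $M$ is the connected component containing $x^0$ of $\{x\in B: F_j(x)=0,\ j=1,\dots,l\}$. Generalized solution in $B$: for a sequence $\{x^n\}\subset B$ satisfying $( * )$, let $T_n$ be the closure of the connected component containing $x^n$ of the solution manifold $\{x\in B: F_j(x)=F_j(x^n),\ j=1,\dots,l,\ \operatorname{rank}J(x)=l\}$. On a subsequence (denoted by $\alpha$) one has $T_n\to T_\alpha$ in the Hausdorff–Pompeiu metric, with $T_\alpha$ compact and connected. Then $T=\bigcup_\alpha T_\alpha$, the union being taken over all sequences satisfying $( * )$ and all their subsequences along which $T_n$ converges.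
   Formalization: The formal theorem assumes that x^0 is the only critical point in the whole closed ball B, boundary sphere included; with uniqueness only in the interior of B the claim T=M can fail. *)

theory Defs
  imports "HOL-Analysis.Analysis"
begin

(* A system of l scalar functions of d variables is a map F :: real^'d => real^'l with
   l = CARD('l), d = CARD('d) and F_j x = F x $ j. *)

definition C1_on :: "(real^'d) set \<Rightarrow> (real^'d \<Rightarrow> real^'l) \<Rightarrow> bool" where
  "C1_on \<Omega> F \<longleftrightarrow>
     (\<forall>x\<in>\<Omega>. F differentiable (at x)) \<and> continuous_on \<Omega> (\<lambda>x. jacobian F (at x))"

definition critical_point :: "(real^'d \<Rightarrow> real^'l) \<Rightarrow> real^'d \<Rightarrow> bool" where
  "critical_point F x \<longleftrightarrow> (\<forall>j. F x $ j = 0) \<and> rank (jacobian F (at x)) < CARD('l)"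

definition regular_sequence ::
    "(real^'d) set \<Rightarrow> (real^'d \<Rightarrow> real^'l) \<Rightarrow> real^'d \<Rightarrow> (nat \<Rightarrow> real^'d) \<Rightarrow> bool" where
  "regular_sequence S F x0 X \<longleftrightarrow>
     (\<forall>n. X n \<in> S \<and> rank (jacobian F (at (X n))) = CARD('l)) \<and> X \<longlonglongrightarrow> x0"

definition solution_manifold ::
    "(real^'d) set \<Rightarrow> (real^'d \<Rightarrow> real^'l) \<Rightarrow> real^'d \<Rightarrow> (real^'d) set" where
  "solution_manifold B F a =
     {x \<in> B. (\<forall>j. F x $ j = F a $ j) \<and> rank (jacobian F (at x)) = CARD('l)}"

definition closed_branch ::
    "(real^'d) set \<Rightarrow> (real^'d \<Rightarrow> real^'l) \<Rightarrow> real^'d \<Rightarrow> (real^'d) set" where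
  "closed_branch B F a = closure (connected_component_set (solution_manifold B F a) a)"

(* A metric on the nonempty compact sets; elsewhere the suprema and infdist may take
   meaningless default values. *)
definition hausdorff_dist :: "'a::metric_space set \<Rightarrow> 'a set \<Rightarrow> real" where
  "hausdorff_dist A B = max (SUP a\<in>A. infdist a B) (SUP b\<in>B. infdist b A)"

(* For bounded B and a sequence in B satisfying the requirements below, every closed branch is
   nonempty and compact, so hausdorff_dist is only used where it is a metric. *)
definition generalized_solution ::
    "(real^'d) set \<Rightarrow> (real^'d \<Rightarrow> real^'l) \<Rightarrow> real^'d \<Rightarrow> (real^'d) set" where
  "generalized_solution B F x0 =
     \<Union>{K. compact K \<and> K \<noteq> {} \<and>
         (\<exists>X s. regular_sequence B F x0 X \<and> strict_mono (s :: nat \<Rightarrow> nat) \<and>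
            (\<lambda>n. hausdorff_dist (closed_branch B F (X (s n))) K) \<longlonglongrightarrow> 0)}"

end

theory Submission
  imports Defs
begin

text \<open>
  Write \<open>Z\<close> for the zero set of \<open>F\<close> in the ball \<open>B\<close>. By the Sura-Bura theorem the component \<open>M\<close> of
  \<open>Z\<close> has arbitrarily small open neighbourhoods whose frontier misses \<open>Z\<close>. On the compact part of
  such a frontier in \<open>B\<close> the map \<open>F\<close> stays away from \<open>0\<close>, so a connected part of a level set of
  \<open>F\<close> through a point near \<open>x0\<close> cannot cross it. Hence the branches accumulate only at \<open>M\<close>, which
  gives \<open>T \<subseteq> M\<close>, and they shrink to \<open>x0\<close> if \<open>M = {x0}\<close>. For \<open>y \<in> M - {x0}\<close> the boundary bumping
  theorem shows that the component of \<open>y\<close> in \<open>Z - {x0}\<close> accumulates at \<open>x0\<close>; all points of this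
  component are regular, so a sequence in it converging to \<open>x0\<close> has a constant branch containing
  \<open>y\<close> and \<open>x0\<close>.
\<close>

section \<open>Hausdorff distance and membership in the generalized solution\<close>

lemma infdist_le_hausdorff_dist:
  assumes "compact K" "y \<in> K"
  shows "infdist y A \<le> hausdorff_dist A K"
proof -
  have "compact ((\<lambda>b. infdist b A) ` K)"
    using assms(1) by (intro compact_continuous_image continuous_intros)
  \<comment> \<open>A real \<open>SUP\<close> is only known to dominate its terms when they are
    bounded above; compactness of \<open>K\<close> supplies this.\<close>
  then have "bdd_above ((\<lambda>b. infdist b A) ` K)"
    by (simp add: compact_imp_bounded bounded_imp_bdd_above)
  then have "infdist y A \<le> (SUP b\<in>K. infdist b A)"
    using assms(2) by (rule cSUP_upper2) simp_all
  then show ?thesis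
    by (simp add: hausdorff_dist_def)
qed

lemma hausdorff_dist_self:
  assumes "A \<noteq> {}"
  shows "hausdorff_dist A A = 0"
  using assms by (simp add: hausdorff_dist_def cong: SUP_cong)

lemma hausdorff_dist_singleton_le:
  assumes "A \<noteq> {}" "A \<subseteq> cball x e"
  shows "hausdorff_dist A {x} \<le> e"
proof -
  obtain a where a: "a \<in> A" using assms(1) by blast
  have "infdist x A \<le> e"
    using infdist_le2[OF a] a assms(2) by (auto simp: subset_iff)
  moreover have "(SUP a\<in>A. infdist a {x}) \<le> e"
    using assms by (intro cSUP_least) (auto simp: dist_commute)
  ultimately show ?thesis
    by (simp add: hausdorff_dist_def)
qed

lemma generalized_solutionI:
  assumes "compact K" "y \<in> K" "regular_sequence B F x0 X"
    and "(\<lambda>n. hausdorff_dist (closed_branch B F (X n)) K) \<longlonglongrightarrow> 0"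
  shows "y \<in> generalized_solution B F x0"
proof -
  have "(\<lambda>n. hausdorff_dist (closed_branch B F (X (id n))) K) \<longlonglongrightarrow> 0"
    using assms(4) by simp
  then have "\<exists>X s. regular_sequence B F x0 X \<and> strict_mono (s :: nat \<Rightarrow> nat) \<and>
      (\<lambda>n. hausdorff_dist (closed_branch B F (X (s n))) K) \<longlonglongrightarrow> 0"
    using assms(3) strict_mono_id by blast
  then show ?thesis
    using assms(1,2) by (auto simp: generalized_solution_def)
qed

section \<open>Boundary bumping and level sets near a component\<close>

lemma boundary_bumping_point:
  fixes x :: "'a::metric_space"
  assumes "compact M" "connected M" "x \<in> M" "y \<in> M - {x}"
  shows "x \<in> closure (connected_component_set (M - {x}) y)"
proof -
  let ?X = "top_of_set M" and ?C = "connected_component_set (M - {x}) y"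
  have sub: "subtopology ?X (M - {x}) = top_of_set (M - {x})"
    by (simp add: subtopology_subtopology Int_absorb1)
  have "?C \<in> connected_components_of (subtopology ?X (M - {x}))"
    unfolding sub connected_components_of_def connected_component_of_def connected_component_def
    using assms(4) by (auto simp: connectedin_subtopology)
  moreover have "compact_space ?X" "connected_space ?X" "Hausdorff_space ?X"
    using assms(1,2)
    by (simp_all add: compact_space_subtopology connectedin_iff_connected[symmetric] connectedin_def
        Hausdorff_space_subtopology)
  moreover have "M - {x} \<subset> topspace ?X"
    using assms(3) by auto
  ultimately have "?X frontier_of ?C \<inter> ?X frontier_of (M - {x}) \<noteq> {}"
    by (metis boundary_bumping_theorem)
  \<comment> \<open>As \<open>M - {x}\<close> is open in \<open>M\<close>, its frontier can only
    contain \<open>x\<close>. The frontier of \<open>?C\<close> meets it, hence contains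
    \<open>x\<close>.\<close>
  moreover have "?X frontier_of (M - {x}) \<subseteq> {x}"
  proof -
    have "openin ?X (M - {x})"
      by (simp add: openin_delete)
    then show ?thesis
      using frontier_of_subset_topspace[of ?X "M - {x}"]
      by (auto simp: frontier_of_def interior_of_openin)
  qed
  ultimately have "x \<in> ?X closure_of ?C"
    by (auto simp: frontier_of_def)
  then show ?thesis
    using closure_mono[of "M \<inter> ?C" ?C] by (auto simp: closure_of_subtopology)
qed

text \<open>The open set \<open>W\<close> is left free for two uses: the complement of a closed ball
  around a point off the component excludes that point from every limit, and a small ball around
  \<open>x0\<close> forces branches to shrink when the component is \<open>{x0}\<close>.\<close>

lemma level_branches_eventually_near_component:
  fixes f :: "'a::euclidean_space \<Rightarrow> 'b::metric_space"
  assumes S: "compact S" and f: "continuous_on S f"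
    and X: "\<And>n. X n \<in> S" "X \<longlonglongrightarrow> x0"
    and C: "\<And>n. connected (C n)" "\<And>n. X n \<in> C n" "\<And>n. C n \<subseteq> {x \<in> S. f x = f (X n)}"
    and W: "open W" "connected_component_set {x \<in> S. f x = f x0} x0 \<subseteq> W"
  shows "\<forall>\<^sub>F n in sequentially. closure (C n) \<subseteq> W"
proof -
  let ?Z = "{x \<in> S. f x = f x0}"
  let ?M = "connected_component_set ?Z x0"
  have x0: "x0 \<in> S"
    using closed_sequentially[OF compact_imp_closed[OF S]] X by blast
  have "?Z = S \<inter> f -` {f x0}" by auto
  then have Z: "compact ?Z"
    using continuous_closedin_preimage[OF f closed_singleton[of "f x0"]] S
    by (metis closedin_compact)
  have comp: "?M \<in> components ?Z"
    using x0 by (auto simp: components_def)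
  obtain K where K: "openin (top_of_set ?Z) K" "compact K" "?M \<subseteq> K" "K \<subseteq> W"
    by (rule Sura_Bura_clopen_subset[OF closed_imp_locally_compact[OF compact_imp_closed[OF Z]]
          comp compact_components[OF Z comp] W])
  obtain G where G: "open G" "K = ?Z \<inter> G"
    using K(1) by (auto simp: openin_open)
  \<comment> \<open>Separating \<open>K\<close> from the complement of \<open>W \<inter> G\<close>,
    not merely of \<open>W\<close>, keeps \<open>closure V\<close> inside \<open>G\<close>, where
    \<open>?Z\<close> reduces to \<open>K\<close>. Since \<open>K\<close> lies in the open set
    \<open>V\<close>, no point of \<open>?Z\<close> is left on the frontier of
    \<open>V\<close>.\<close>
  have "closed (- (W \<inter> G))" "K \<inter> - (W \<inter> G) = {}"
    using W(1) G K(4) by auto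
  then obtain V V' where V: "open V" "open V'" "K \<subseteq> V" "- (W \<inter> G) \<subseteq> V'" "V \<inter> V' = {}"
    by (rule separation_normal_compact[OF K(2)])
  have "closure V \<inter> V' = {}"
    using V by (metis inf_commute open_Int_closure_eq_empty)
  then have clV: "closure V \<subseteq> W \<inter> G"
    using V(4) by blast
  have fr: "frontier V \<inter> ?Z = {}"
    using clV V(1,3) G(2) by (auto simp: frontier_def interior_open)
  have "compact (f ` (frontier V \<inter> S))"
    using S f by (intro compact_continuous_image)
      (auto intro: continuous_on_subset closed_Int_compact)
  then have "open (- f ` (frontier V \<inter> S))"
    by (simp add: compact_imp_closed open_Compl)
  moreover have "f x0 \<in> - f ` (frontier V \<inter> S)"
    using fr by force
  moreover have "(\<lambda>n. f (X n)) \<longlonglongrightarrow> f x0"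
    using f X x0 by (intro continuous_on_tendsto_compose[OF f X(2)]) auto
  ultimately have "\<forall>\<^sub>F n in sequentially. f (X n) \<in> - f ` (frontier V \<inter> S)"
    by (metis topological_tendstoD)
  moreover have "x0 \<in> ?M"
    using x0 by simp
  then have "x0 \<in> V"
    using K(3) V(3) by blast
  then have "\<forall>\<^sub>F n in sequentially. X n \<in> V"
    using X(2) V(1) by (simp add: topological_tendstoD)
  ultimately show ?thesis
  proof eventually_elim
    case (elim n)
    have "z \<notin> frontier V" if "z \<in> C n" for z
    proof -
      have "z \<in> S" "f z = f (X n)"
        using that C(3)[of n] by auto
      then show ?thesis
        using elim(1) by (metis ComplD IntI imageI)
    qed
    then have "C n \<subseteq> V"
      using connected_Int_frontier[OF C(1)[of n], of V] C(2)[of n] elim(2) by blast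
    then show ?case
      using clV closure_mono by (metis inf.bounded_iff order_trans)
  qed
qed

section \<open>The generalized solution in the ball\<close>

lemma C1_on_imp_continuous_on:
  assumes "C1_on \<Omega> F" "S \<subseteq> \<Omega>"
  shows "continuous_on S F"
  using assms
  by (auto simp: C1_on_def intro!: continuous_at_imp_continuous_on differentiable_imp_continuous_within)

context
  fixes F :: "real^'d \<Rightarrow> real^'l" and x0 :: "real^'d" and r :: real
    and B Z M
  defines "B \<equiv> cball x0 r" and "Z \<equiv> {x \<in> B. F x = 0}" and "M \<equiv> connected_component_set Z x0"
  assumes contF: "continuous_on B F"
    and crit: "{x \<in> B. critical_point F x} = {x0}"
begin

lemma zero_at_center: "F x0 = 0" and center_in_zero_set: "x0 \<in> Z"
  using crit by (auto simp: critical_point_def vec_eq_iff Z_def)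

lemma compact_component: "compact M"
proof -
  have "Z = B \<inter> F -` {0}" by (auto simp: Z_def)
  then have "compact Z"
    using continuous_closedin_preimage[OF contF closed_singleton[of 0]]
    by (metis closedin_compact B_def compact_cball)
  then show ?thesis
    using center_in_zero_set compact_components[of Z M] by (auto simp: components_def M_def)
qed

lemma closed_branch_eventually_near_component:
  assumes "regular_sequence B F x0 X" "open W" "M \<subseteq> W"
  shows "\<forall>\<^sub>F n in sequentially. closed_branch B F (X n) \<subseteq> W"
  unfolding closed_branch_def
proof (rule level_branches_eventually_near_component[of B F X x0])
  show "connected_component_set (solution_manifold B F (X n)) (X n) \<subseteq> {x \<in> B. F x = F (X n)}" for n
    using connected_component_subset[of "solution_manifold B F (X n)" "X n"]
    by (auto simp: solution_manifold_def vec_eq_iff)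
qed (use assms contF zero_at_center in
    \<open>auto simp: regular_sequence_def solution_manifold_def B_def M_def Z_def\<close>)

lemma in_closed_branch:
  assumes "regular_sequence B F x0 X"
  shows "X n \<in> closed_branch B F (X n)"
  unfolding closed_branch_def
  by (rule subsetD[OF closure_subset]) (use assms in
    \<open>auto simp: regular_sequence_def solution_manifold_def\<close>)

lemma generalized_solution_subset: "generalized_solution B F x0 \<subseteq> M"
proof
  fix y assume "y \<in> generalized_solution B F x0"
  then obtain K X s where K: "compact K" "y \<in> K" and X: "regular_sequence B F x0 X"
    and s: "strict_mono (s :: nat \<Rightarrow> nat)"
    and lim: "(\<lambda>n. hausdorff_dist (closed_branch B F (X (s n))) K) \<longlonglongrightarrow> 0"
    by (auto simp: generalized_solution_def)
  show "y \<in> M"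
  proof (rule ccontr)
    assume "y \<notin> M"
    moreover have "open (- M)"
      using compact_imp_closed[OF compact_component] by (simp add: open_Compl)
    ultimately obtain e where e: "0 < e" "cball y e \<inter> M = {}"
      unfolding open_contains_cball by blast
    \<comment> \<open>The ball is closed so that its complement is an admissible open neighbourhood
      of \<open>M\<close>. Branches inside that complement stay at distance at least
      \<open>e\<close> from \<open>y \<in> K\<close>, against Hausdorff convergence to
      \<open>K\<close>.\<close>
    have "\<forall>\<^sub>F n in sequentially. closed_branch B F (X n) \<subseteq> - cball y e"
      using e(2) by (intro closed_branch_eventually_near_component[OF X]) auto
    then have "\<forall>\<^sub>F n in sequentially. closed_branch B F (X (s n)) \<subseteq> - cball y e"
      using eventually_subseq[OF s] by blast
    moreover have "\<forall>\<^sub>F n in sequentially. hausdorff_dist (closed_branch B F (X (s n))) K < e"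
      using order_tendstoD(2)[OF lim e(1)] .
    ultimately have "\<forall>\<^sub>F n :: nat in sequentially. False"
    proof eventually_elim
      case (elim n)
      have ne: "closed_branch B F (X (s n)) \<noteq> {}"
        using in_closed_branch[OF X] by blast
      have "e \<le> infdist y (closed_branch B F (X (s n)))"
        unfolding infdist_notempty[OF ne] using elim(1) by (intro cINF_greatest[OF ne]) force
      then show ?case
        using infdist_le_hausdorff_dist[OF K, of "closed_branch B F (X (s n))"] elim(2) by linarith
    qed
    then show False by simp
  qed
qed

text \<open>The rank is at most \<open>CARD('l)\<close>, so a zero in \<open>B\<close> is regular
  unless it is critical, and only \<open>x0\<close> is critical. All zeros thus share one manifold,
  which makes branches constant along each of its components.\<close>

lemma solution_manifold_zero:
  assumes "F x = 0"
  shows "solution_manifold B F x = Z - {x0}"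
proof -
  have "rank (jacobian F (at z)) = CARD('l) \<longleftrightarrow> \<not> rank (jacobian F (at z)) < CARD('l)" for z
    using rank_bound[of "jacobian F (at z)"] by auto
  then show ?thesis
    using crit assms by (auto simp: solution_manifold_def critical_point_def Z_def vec_eq_iff)
qed

text \<open>One branch contains both points: \<open>y\<close> lies in the component
  \<open>D\<close>, and \<open>x0\<close> is reached by its closure. So a second point of
  \<open>M\<close> also settles \<open>x0\<close> itself.\<close>

lemma component_branch_subset_generalized_solution:
  assumes y: "y \<in> M - {x0}"
  shows "{x0, y} \<subseteq> generalized_solution B F x0"
proof -
  define D where "D = connected_component_set (Z - {x0}) y"
  have MZ: "M \<subseteq> Z"
    by (simp add: M_def connected_component_subset)
  \<comment> \<open>Boundary bumping needs a connected compact space, so it is applied in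
    \<open>M\<close>; the result is then carried over to the possibly larger component in
    \<open>Z - {x0}\<close>.\<close>
  have "connected_component_set (M - {x0}) y \<subseteq> D"
    using MZ unfolding D_def by (intro connected_component_mono) auto
  moreover have "x0 \<in> closure (connected_component_set (M - {x0}) y)"
    using compact_component y center_in_zero_set
    by (intro boundary_bumping_point) (auto simp: M_def)
  ultimately have x0D: "x0 \<in> closure D"
    using closure_mono by blast
  then obtain X where X: "\<And>n. X n \<in> D" "X \<longlonglongrightarrow> x0"
    by (auto simp: closure_sequential)
  have DZ: "D \<subseteq> Z - {x0}"
    by (simp add: D_def connected_component_subset)
  have F0: "F (X n) = 0" for n
    using X(1)[of n] DZ by (auto simp: Z_def)
  have "X n \<in> solution_manifold B F (X n)" for n
    using X(1)[of n] DZ by (auto simp: solution_manifold_zero[OF F0])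
  then have reg: "regular_sequence B F x0 X"
    using X(2) by (auto simp: regular_sequence_def solution_manifold_def)
  \<comment> \<open>Every \<open>X n\<close> lies in the same component \<open>D\<close>, so the
    Hausdorff distances to \<open>closure D\<close> are all zero.\<close>
  have "closed_branch B F (X n) = closure D" for n
    using X(1)[of n] unfolding closed_branch_def solution_manifold_zero[OF F0] D_def
    by (metis connected_component_eq)
  then have "(\<lambda>n. hausdorff_dist (closed_branch B F (X n)) (closure D)) \<longlonglongrightarrow> 0"
    using hausdorff_dist_self[of "closure D"] X(1) by (cases "D = {}") auto
  moreover have "compact (closure D)"
    using DZ unfolding compact_closure
    by (intro bounded_subset[OF bounded_cball, of _ x0 r]) (auto simp: Z_def B_def)
  ultimately have "closure D \<subseteq> generalized_solution B F x0"
    using reg generalized_solutionI[of "closure D"] by blast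
  moreover have "y \<in> D"
    using y MZ by (auto simp: D_def)
  ultimately show ?thesis
    using x0D closure_subset by blast
qed

text \<open>Here \<open>M\<close> offers no regular zeros, so the given regular sequence serves: its
  branches end up in arbitrarily small balls around \<open>x0\<close> and converge to
  \<open>{x0}\<close>.\<close>

lemma center_in_generalized_solution_if_isolated:
  assumes M: "M = {x0}" and X: "regular_sequence B F x0 X"
  shows "x0 \<in> generalized_solution B F x0"
proof -
  let ?h = "\<lambda>n. hausdorff_dist (closed_branch B F (X n)) {x0}"
  have "?h \<longlonglongrightarrow> 0"
  proof (rule tendstoI)
    fix e :: real assume "0 < e"
    then have "\<forall>\<^sub>F n in sequentially. closed_branch B F (X n) \<subseteq> ball x0 (e / 2)"
      using M by (intro closed_branch_eventually_near_component[OF X]) auto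
    then show "\<forall>\<^sub>F n in sequentially. dist (?h n) 0 < e"
    proof eventually_elim
      case (elim n)
      then have "?h n \<le> e / 2"
        using in_closed_branch[OF X, of n] ball_subset_cball
        by (intro hausdorff_dist_singleton_le) blast+
      \<comment> \<open>\<open>hausdorff_dist\<close> is not nonnegative by definition; the bound
        comes from the distance of \<open>x0\<close> to the branch.\<close>
      moreover have "0 \<le> ?h n"
        using infdist_le_hausdorff_dist[of "{x0}" x0 "closed_branch B F (X n)"]
          infdist_nonneg[of x0 "closed_branch B F (X n)"] by simp
      ultimately show ?case
        using \<open>0 < e\<close> by simp
    qed
  qed
  then show ?thesis
    using X by (intro generalized_solutionI) auto
qed

lemma generalized_solution_eq_component:
  assumes "regular_sequence B F x0 X"
  shows "generalized_solution B F x0 = M"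
proof
  show "generalized_solution B F x0 \<subseteq> M"
    by (rule generalized_solution_subset)
  have x0: "x0 \<in> M"
    using center_in_zero_set by (simp add: M_def)
  show "M \<subseteq> generalized_solution B F x0"
  proof (cases "M = {x0}")
    case True
    then show ?thesis
      using center_in_generalized_solution_if_isolated assms by simp
  next
    case False
    then show ?thesis
      using component_branch_subset_generalized_solution x0 by blast
  qed
qed

end

text \<open>Dropping an initial segment moves the standing regular sequence from the domain into the
  ball, where the branches are formed.\<close>

lemma regular_sequence_in_ball:
  assumes "regular_sequence S F x0 X" "0 < r"
  obtains Y where "regular_sequence (cball x0 r) F x0 Y"
proof -
  have lim: "X \<longlonglongrightarrow> x0" using assms(1) by (simp add: regular_sequence_def)
  then have "\<forall>\<^sub>F n in sequentially. X n \<in> ball x0 r"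
    using assms(2) by (intro topological_tendstoD) auto
  then obtain N where "\<And>n. N \<le> n \<Longrightarrow> X n \<in> ball x0 r"
    by (auto simp: eventually_sequentially)
  then have "regular_sequence (cball x0 r) F x0 (\<lambda>n. X (n + N))"
    using assms(1) LIMSEQ_ignore_initial_segment[OF lim, of N]
    by (auto simp: regular_sequence_def less_imp_le)
  then show thesis by (rule that)
qed

theorem proposition3:
  fixes F :: "real^'d \<Rightarrow> real^'l" and \<Omega> :: "(real^'d) set" and x0 :: "real^'d" and r :: real
  assumes "CARD('l) < CARD('d)"
    and "open \<Omega>" and "connected \<Omega>" and "bounded \<Omega>" and "x0 \<in> \<Omega>"
    and "C1_on \<Omega> F" and "\<forall>j. F x0 $ j = 0"
    and "\<exists>X. regular_sequence \<Omega> F x0 X"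
    and "0 < r" and "cball x0 r \<subseteq> \<Omega>"
    and "{x \<in> cball x0 r. critical_point F x} = {x0}"
  shows "generalized_solution (cball x0 r) F x0 =
         connected_component_set {x \<in> cball x0 r. \<forall>j. F x $ j = 0} x0"
proof -
  obtain X where "regular_sequence (cball x0 r) F x0 X"
    using assms(8,9) regular_sequence_in_ball by blast
  moreover have "continuous_on (cball x0 r) F"
    using C1_on_imp_continuous_on[OF assms(6,10)] .
  ultimately have "generalized_solution (cball x0 r) F x0 =
      connected_component_set {x \<in> cball x0 r. F x = 0} x0"
    using generalized_solution_eq_component assms(11) by blast
  then show ?thesis
    by (simp add: vec_eq_iff)
qed

end
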